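(* Let $G$ be a connected finite simple graph and let $k \geq 2$ be an integer. Let $S \subseteq V(G)$ be such that $\alpha_G(S) \leq k + \kappa_G(S) - 1$. Then $G$ has a tree $T$ (a subgraph of $G$ that is a tree) such that $T$ covers $S$, i.e. $S \subseteq V(T)$, and $T$ has at most $k-2$ branch vertices.
   Context: All graphs are finite and simple. For a graph $G$ and $S \subseteq V(G)$, $\alpha_G(S)$ denotes the maximum cardinality of a subset of $S$ that is independent in $G$ (no two of its vertices are adjacent in $G$). For two distinct vertices $x, y$ of $G$, the local connectivity $\kappa_G(x,y)$ is the maximum number of pairwise internally disjoint paths connecting $x$ and $y$ in $G$ (if $x,y$ are adjacent, the edge $xy$ counts as one such path). Define $\kappa_G(S) := \min\{\kappa_G(x,y) : x,y \in S,\ x \neq y\}$ if $|S| \geq 2$, and $\kappa_G(S) := +\infty$ if $|S| \leq 1$. A branch vertex of a tree $T$ is a vertex of degree at least three in $T$. The tree $T$ need not be spanning. *)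

theory Defs
  imports "Graph_Theory.Kuratowski" "HOL-Library.Extended_Nat"
begin

text \<open>
  A finite simple graph is a \<^locale>\<open>pair_graph\<close>: a finite, loop-free, symmetric digraph whose arcs
  are pairs of vertices. An undirected edge \<open>uv\<close> is the pair of opposite arcs \<open>(u, v)\<close>, \<open>(v, u)\<close>.
\<close>

definition independent_in :: "'a pair_pre_digraph \<Rightarrow> 'a set \<Rightarrow> bool" where
  "independent_in G I \<longleftrightarrow> I \<subseteq> pverts G \<and> (\<forall>x\<in>I. \<forall>y\<in>I. x \<noteq> y \<longrightarrow> (x, y) \<notin> parcs G)"

definition independence_number_on :: "'a pair_pre_digraph \<Rightarrow> 'a set \<Rightarrow> nat" where
  "independence_number_on G S = Max {card I | I. I \<subseteq> S \<and> independent_in G I}"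

text \<open>
  In a \<^locale>\<open>pair_graph\<close> a path from \<open>x\<close> to \<open>y\<close> is determined by its list of arcs, so a family of
  distinct paths is a set of such lists; in particular an edge \<open>xy\<close> contributes only the one path
  \<open>[(x, y)]\<close>, which has no inner vertices.
\<close>

definition internally_disjoint_paths ::
    "'a pair_pre_digraph \<Rightarrow> 'a \<Rightarrow> 'a \<Rightarrow> ('a \<times> 'a) awalk set \<Rightarrow> bool" where
  "internally_disjoint_paths G x y P \<longleftrightarrow>
     (\<forall>p\<in>P. pre_digraph.apath (with_proj G) x p y) \<and>
     pairwise (\<lambda>p q. set (pre_digraph.inner_verts (with_proj G) p) \<inter>
                     set (pre_digraph.inner_verts (with_proj G) q) = {}) P"

definition local_connectivity :: "'a pair_pre_digraph \<Rightarrow> 'a \<Rightarrow> 'a \<Rightarrow> nat" where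
  "local_connectivity G x y = Max {card P | P. internally_disjoint_paths G x y P}"

definition connectivity_on :: "'a pair_pre_digraph \<Rightarrow> 'a set \<Rightarrow> enat" where
  "connectivity_on G S =
     (if 2 \<le> card S
      then enat (Min {local_connectivity G x y | x y. x \<in> S \<and> y \<in> S \<and> x \<noteq> y})
      else \<infinity>)"

text \<open>
  The library's \<^const>\<open>tree\<close> is not the undirected notion: in a symmetric digraph every edge gives a
  directed cycle of length 2. The cycles of the underlying undirected graph are the directed cycles
  of length at least 3.
\<close>

definition undirected_tree :: "'a pair_pre_digraph \<Rightarrow> bool" where
  "undirected_tree T \<longleftrightarrow>
     pair_graph T \<and> Digraph_Component.connected (with_proj T) \<and>
     \<not> (\<exists>c. pre_digraph.cycle (with_proj T) c \<and> 3 \<le> length c)"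

text \<open>In a symmetric digraph the in-degree is the degree of the underlying undirected graph.\<close>

definition branch_vertices :: "'a pair_pre_digraph \<Rightarrow> 'a set" where
  "branch_vertices T = {v \<in> pverts T. 3 \<le> in_degree (with_proj T) v}"

end

theory Submission
  imports Defs
begin

text \<open>
  Write \<open>\<alpha>(Y)\<close> for the independence number of \<open>Y\<close> in \<open>G\<close> and \<open>\<kappa>\<close> for the connectivity of \<open>S\<close>.
  The proof has two halves.

  \<^bold>\<open>A path that lowers the independence number.\<close> Some path \<open>P\<close> either contains \<open>S\<close> or satisfies
  \<open>\<alpha>(S - P) + \<kappa> + 1 \<le> \<alpha>(S)\<close>; under the hypothesis both give \<open>\<alpha>(S - P) \<le> k - 2\<close>. This sharpens
  the Chvatal-Erdos argument, in which \<open>P\<close> covers as much of \<open>S\<close> as possible: here \<open>P\<close> minimises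
  \<open>\<alpha>(S - P)\<close> and, subject to that, leaves uncovered a vertex \<open>s \<in> S\<close> whose component \<open>D\<close> of
  \<open>G - P\<close> is as small as possible. Let \<open>U\<close> be the set of neighbours of \<open>D\<close> on \<open>P\<close> and let \<open>A\<close> be the
  part of \<open>S - P\<close> outside \<open>D\<close>. By minimality, no path enters \<open>D\<close>, keeps all of \<open>U\<close> and gives up only
  vertices of \<open>P\<close> whose addition to \<open>A\<close> leaves \<open>\<alpha>(A)\<close> unchanged (\<open>no_exchange\<close>). The vertices of \<open>U\<close>
  cut \<open>P\<close> into \<open>card U + 1\<close> gaps. A detour through \<open>D\<close> can skip a gap, so every gap must raise
  \<open>\<alpha>(A)\<close>; take the shortest initial segment of each gap that does so. If two segments were joined by
  an edge or through \<open>A\<close>, the Chvatal-Erdos rerouting through \<open>D\<close> and the first such link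
  would be a forbidden exchange. Hence the segments raise \<open>\<alpha>(A)\<close> independently of each other, and
  \<open>\<alpha>(S) \<ge> \<alpha>(S - P) + card U + 1\<close> (\<open>alpha_ge_attachments\<close>). Finally \<open>U\<close> separates \<open>s\<close> from a vertex
  of \<open>S\<close> on \<open>P\<close>, so \<open>\<kappa> \<le> card U\<close> by the easy direction of Menger's theorem.

  \<^bold>\<open>Growing the path to a tree.\<close> As long as a tree \<open>T\<close> misses part of \<open>S\<close>, attach to it a path that
  runs outside \<open>T\<close>, ends in \<open>S\<close> and collects as many vertices of \<open>S\<close> as possible. Its end has no
  neighbour left in the uncovered part of \<open>S\<close>, so the independence number of that part drops. One step
  creates at most one branch vertex, the point of attachment. Starting from \<open>P\<close>, which has no branch
  vertex, at most \<open>\<alpha>(S - P) \<le> k - 2\<close> of them arise (\<open>subtree_covering\<close>).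
\<close>

section \<open>The independence number\<close>

context pair_graph
begin

abbreviation alpha :: "'a set \<Rightarrow> nat" where
  "alpha \<equiv> independence_number_on G"

lemma alpha_candidates_finite: "finite {card I | I. I \<subseteq> Y \<and> independent_in G I}"
proof -
  have "{card I | I. I \<subseteq> Y \<and> independent_in G I} \<subseteq> card ` Pow (pverts G)"
    by (auto simp: independent_in_def)
  then show ?thesis
    using pair_finite_verts by (meson finite_Pow_iff finite_imageI finite_subset)
qed

lemma card_le_alpha: "I \<subseteq> Y \<Longrightarrow> independent_in G I \<Longrightarrow> card I \<le> alpha Y"
  unfolding independence_number_on_def
  by (rule Max_ge[OF alpha_candidates_finite]) auto

lemma alpha_attained:
  obtains I where "I \<subseteq> Y" "independent_in G I" "card I = alpha Y" "finite I"
proof -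
  have "{card I | I. I \<subseteq> Y \<and> independent_in G I} \<noteq> {}"
    by (auto simp: independent_in_def)
  from Max_in[OF alpha_candidates_finite this] obtain I where
    "I \<subseteq> Y" "independent_in G I" "card I = alpha Y"
    unfolding independence_number_on_def by auto
  moreover from this have "finite I"
    using pair_finite_verts finite_subset[of I "pverts G"] by (auto simp: independent_in_def)
  ultimately show thesis using that by blast
qed

lemma independent_in_subset: "independent_in G I \<Longrightarrow> J \<subseteq> I \<Longrightarrow> independent_in G J"
  by (auto simp: independent_in_def)

lemma alpha_mono: "Y \<subseteq> Z \<Longrightarrow> alpha Y \<le> alpha Z"
  by (metis alpha_attained card_le_alpha order_trans)

lemma alpha_pos: "y \<in> Y \<Longrightarrow> y \<in> pverts G \<Longrightarrow> 1 \<le> alpha Y"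
  using card_le_alpha[of "{y}" Y] by (auto simp: independent_in_def)

lemma alpha_Un_le: "alpha (Y \<union> Z) \<le> alpha Y + alpha Z"
proof -
  obtain I where I: "I \<subseteq> Y \<union> Z" "independent_in G I" "card I = alpha (Y \<union> Z)" "finite I"
    by (rule alpha_attained)
  have "card I \<le> card (I \<inter> Y) + card (I \<inter> Z)"
    using I card_Un_le[of "I \<inter> Y" "I \<inter> Z"] by (simp flip: Int_Un_distrib add: Int_absorb2)
  also have "\<dots> \<le> alpha Y + alpha Z"
    by (intro add_mono card_le_alpha) (use I independent_in_subset in auto)
  finally show ?thesis using I by simp
qed

lemma parcs_sym: "(x, y) \<in> parcs G \<longleftrightarrow> (y, x) \<in> parcs G"
  using pair_sym_arcs by (metis arcs_symmetric)

lemma alpha_Un_disjoint: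
  assumes "Y \<inter> Z = {}" "\<And>y z. y \<in> Y \<Longrightarrow> z \<in> Z \<Longrightarrow> (y, z) \<notin> parcs G"
  shows "alpha (Y \<union> Z) = alpha Y + alpha Z"
proof (rule antisym[OF alpha_Un_le])
  obtain I where I: "I \<subseteq> Y" "independent_in G I" "card I = alpha Y" "finite I"
    by (rule alpha_attained)
  obtain J where J: "J \<subseteq> Z" "independent_in G J" "card J = alpha Z" "finite J"
    by (rule alpha_attained)
  have "(x, y) \<notin> parcs G \<and> (y, x) \<notin> parcs G" if "x \<in> I" "y \<in> J" for x y
    using that I(1) J(1) assms(2)[of x y] parcs_sym[of y x] by auto
  then have "independent_in G (I \<union> J)"
    using I(2) J(2) unfolding independent_in_def by auto
  then have "card (I \<union> J) \<le> alpha (Y \<union> Z)"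
    using I J by (intro card_le_alpha) auto
  moreover have "card (I \<union> J) = card I + card J"
    using I J assms(1) by (intro card_Un_disjoint) auto
  ultimately show "alpha Y + alpha Z \<le> alpha (Y \<union> Z)" using I J by simp
qed

section \<open>Vertex paths and reachability inside a set\<close>

text \<open>
  Paths are handled as lists of vertices, because the rerouting arguments cut, reverse and reassemble
  them. The empty list is admitted, so that covering nothing is a legitimate candidate.
\<close>
definition list_path :: "'a list \<Rightarrow> bool" where
  "list_path xs \<longleftrightarrow>
     set xs \<subseteq> pverts G \<and> distinct xs \<and> successively (\<lambda>x y. (x, y) \<in> parcs G) xs"

abbreviation reach_in :: "'a set \<Rightarrow> ('a \<times> 'a) set" where
  "reach_in W \<equiv> (Restr (parcs G) W)\<^sup>*"

lemma reach_in_sym: "(x, y) \<in> reach_in W \<Longrightarrow> (y, x) \<in> reach_in W"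
proof -
  have "sym (Restr (parcs G) W)" using parcs_sym by (auto intro!: symI)
  then show "(x, y) \<in> reach_in W \<Longrightarrow> (y, x) \<in> reach_in W" by (meson sym_rtrancl symE)
qed

lemma reach_in_mem: "(x, y) \<in> reach_in W \<Longrightarrow> x \<in> W \<Longrightarrow> y \<in> W"
  by (induction rule: rtrancl_induct) auto

lemma reach_in_path:
  assumes "(x, y) \<in> reach_in W" "x \<in> W" "W \<subseteq> pverts G"
  obtains xs where "list_path xs" "xs \<noteq> []" "hd xs = x" "last xs = y" "set xs \<subseteq> W"
proof -
  from assms(1) have "\<exists>xs. list_path xs \<and> xs \<noteq> [] \<and> hd xs = x \<and> last xs = y \<and> set xs \<subseteq> W"
  proof (induction rule: rtrancl_induct)
    case base
    show ?case using assms by (intro exI[of _ "[x]"]) (auto simp: list_path_def)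
  next
    case (step y z)
    then obtain xs where xs: "list_path xs" "xs \<noteq> []" "hd xs = x" "last xs = y" "set xs \<subseteq> W"
      by blast
    show ?case
    proof (cases "z \<in> set xs")
      case True
      then obtain as bs where "xs = as @ z # bs" by (meson split_list)
      then show ?thesis using xs
        by (intro exI[of _ "as @ [z]"])
          (auto simp: list_path_def successively_append_iff hd_append split: if_splits)
    next
      case False
      then show ?thesis using xs step assms
        by (intro exI[of _ "xs @ [z]"])
          (auto simp: list_path_def successively_append_iff)
    qed
  qed
  then show thesis using that by blast
qed

section \<open>Sets that are not linked\<close>
definition linked :: "'a set \<Rightarrow> 'a \<Rightarrow> 'a \<Rightarrow> bool" where
  "linked A y z \<longleftrightarrow> (y, z) \<in> parcs G \<or>
     (\<exists>a b. (y, a) \<in> parcs G \<and> a \<in> A \<and> (a, b) \<in> reach_in A \<and> (b, z) \<in> parcs G)"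

lemma linked_sym: "linked A y z \<Longrightarrow> linked A z y"
proof (unfold linked_def, elim disjE exE conjE)
  assume "(y, z) \<in> parcs G"
  then show "(z, y) \<in> parcs G \<or>
     (\<exists>a b. (z, a) \<in> parcs G \<and> a \<in> A \<and> (a, b) \<in> reach_in A \<and> (b, y) \<in> parcs G)"
    using parcs_sym[of y z] by simp
next
  fix a b
  assume "(y, a) \<in> parcs G" "a \<in> A" "(a, b) \<in> reach_in A" "(b, z) \<in> parcs G"
  then have "(z, b) \<in> parcs G" "b \<in> A" "(b, a) \<in> reach_in A" "(a, y) \<in> parcs G"
    using parcs_sym[of y a] parcs_sym[of b z] reach_in_sym reach_in_mem[of a b A] by auto
  then show "(z, y) \<in> parcs G \<or>
     (\<exists>a b. (z, a) \<in> parcs G \<and> a \<in> A \<and> (a, b) \<in> reach_in A \<and> (b, y) \<in> parcs G)"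
    by blast
qed

lemma linked_path:
  assumes "linked A y z" "A \<subseteq> pverts G"
  obtains xs where "set xs \<subseteq> A" "distinct xs" "successively (\<lambda>x y. (x, y) \<in> parcs G) (y # xs @ [z])"
  using assms(1) unfolding linked_def
proof
  assume "(y, z) \<in> parcs G"
  then show thesis using that[of "[]"] by simp
next
  assume "\<exists>a b. (y, a) \<in> parcs G \<and> a \<in> A \<and> (a, b) \<in> reach_in A \<and> (b, z) \<in> parcs G"
  then obtain a b where ab: "(y, a) \<in> parcs G" "a \<in> A" "(a, b) \<in> reach_in A" "(b, z) \<in> parcs G"
    by blast
  obtain xs where "list_path xs" "xs \<noteq> []" "hd xs = a" "last xs = b" "set xs \<subseteq> A"
    using reach_in_path[OF ab(3,2) assms(2)] by blast
  then show thesis using that[of xs] ab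
    by (auto simp: list_path_def successively_append_iff successively_Cons)
qed

text \<open>
  Unlinked sets raise the independence number of \<open>A\<close> independently of each other: the part \<open>X\<close> of
  \<open>A\<close> that is reachable from \<open>Z\<close> forms with \<open>Z\<close> a union of components of the induced graph on
  \<open>A \<union> Z \<union> Z'\<close>, so all four independence numbers split along \<open>X\<close>.
\<close>
lemma alpha_Un_unlinked:
  assumes "A \<inter> Z = {}" "A \<inter> Z' = {}" "Z \<inter> Z' = {}"
    and unl: "\<And>z z'. z \<in> Z \<Longrightarrow> z' \<in> Z' \<Longrightarrow> \<not> linked A z z'"
  shows "alpha (A \<union> Z \<union> Z') + alpha A = alpha (A \<union> Z) + alpha (A \<union> Z')"
proof -
  define X where "X = {x. \<exists>z\<in>Z. \<exists>a\<in>A. (z, a) \<in> parcs G \<and> (a, x) \<in> reach_in A}"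
  define A' where "A' = A - X"
  have XA: "X \<subseteq> A" unfolding X_def using reach_in_mem by blast
  have A: "A = X \<union> A'" "X \<inter> A' = {}" using XA unfolding A'_def by auto
  have ZA': "(z, a) \<notin> parcs G" if "z \<in> Z" "a \<in> A'" for z a
    using that unfolding A'_def X_def by blast
  have XA': "(x, a) \<notin> parcs G" if x: "x \<in> X" "a \<in> A'" for x a
  proof
    assume e: "(x, a) \<in> parcs G"
    from x(1) obtain z b where zb: "z \<in> Z" "b \<in> A" "(z, b) \<in> parcs G" "(b, x) \<in> reach_in A"
      unfolding X_def by blast
    have "(x, a) \<in> Restr (parcs G) A" using x e XA A by auto
    with zb have "(b, a) \<in> reach_in A" by (meson rtrancl.rtrancl_into_rtrancl)
    with zb have "a \<in> X" unfolding X_def by blast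
    then show False using x unfolding A'_def by simp
  qed
  have ZZ': "(z, z') \<notin> parcs G" if "z \<in> Z" "z' \<in> Z'" for z z'
    using unl[OF that] unfolding linked_def by blast
  have XZ': "(x, z') \<notin> parcs G" if "x \<in> X" "z' \<in> Z'" for x z'
    using that unl unfolding linked_def X_def by blast
  have "alpha ((X \<union> Z) \<union> (A' \<union> Z')) = alpha (X \<union> Z) + alpha (A' \<union> Z')"
    using assms A ZA' XA' ZZ' XZ' by (intro alpha_Un_disjoint) auto
  moreover have "alpha (X \<union> A') = alpha X + alpha A'"
    using A XA' by (intro alpha_Un_disjoint) auto
  moreover have "alpha ((X \<union> Z) \<union> A') = alpha (X \<union> Z) + alpha A'"
    using assms A ZA' XA' by (intro alpha_Un_disjoint) auto
  moreover have "alpha (X \<union> (A' \<union> Z')) = alpha X + alpha (A' \<union> Z')"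
    using assms A XA' XZ' by (intro alpha_Un_disjoint) auto
  moreover have "A \<union> Z \<union> Z' = (X \<union> Z) \<union> (A' \<union> Z')" "A \<union> Z = (X \<union> Z) \<union> A'"
    "A \<union> Z' = X \<union> (A' \<union> Z')" using A by auto
  ultimately show ?thesis using A by simp
qed

end

section \<open>Intervals of a path\<close>
definition slice_set :: "'a list \<Rightarrow> nat \<Rightarrow> nat \<Rightarrow> 'a set" where
  "slice_set xs a b = (!) xs ` {a..<b}"

lemma set_take_slice: "n \<le> length xs \<Longrightarrow> set (take n xs) = slice_set xs 0 n"
  by (simp add: slice_set_def nth_image)

lemma set_drop_slice: "set (drop n xs) = slice_set xs n (length xs)"
proof -
  have "set (drop n xs) = {xs ! i | i. n \<le> i \<and> i < length xs}"
  proof (intro equalityI subsetI)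
    fix x assume "x \<in> set (drop n xs)"
    then obtain i where "i < length (drop n xs)" "x = drop n xs ! i"
      by (metis in_set_conv_nth)
    then show "x \<in> {xs ! i | i. n \<le> i \<and> i < length xs}"
      by (intro CollectI exI[of _ "n + i"]) auto
  next
    fix x assume "x \<in> {xs ! i | i. n \<le> i \<and> i < length xs}"
    then obtain i where "n \<le> i" "i < length xs" "x = xs ! i" by blast
    then show "x \<in> set (drop n xs)"
      using nth_mem[of "i - n" "drop n xs"] by simp
  qed
  then show ?thesis by (auto simp: slice_set_def)
qed

lemma slice_set_Un: "a \<le> b \<Longrightarrow> b \<le> c \<Longrightarrow> slice_set xs a c = slice_set xs a b \<union> slice_set xs b c"
  by (simp add: slice_set_def ivl_disj_un_two(3) flip: image_Un)

lemma slice_set_disjoint: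
  assumes "distinct xs" "b \<le> length xs" "d \<le> length xs" "b \<le> c \<or> d \<le> a"
  shows "slice_set xs a b \<inter> slice_set xs c d = {}"
  using assms unfolding slice_set_def by (fastforce simp: nth_eq_iff_index_eq)

lemma slice_set_subset: "b \<le> length xs \<Longrightarrow> slice_set xs a b \<subseteq> set xs"
  by (auto simp: slice_set_def)

lemma slice_set_mono: "c \<le> a \<Longrightarrow> b \<le> d \<Longrightarrow> slice_set xs a b \<subseteq> slice_set xs c d"
  by (auto simp: slice_set_def)

section \<open>Paths that minimise the independence number of the uncovered part\<close>

text \<open>
  The second minimality condition decides between the paths that are optimal for the first: an
  exchange that covers a further vertex of \<open>S\<close> need not lower the independence number, but it makes
  the component of an uncovered vertex smaller.
\<close>
locale minimal_path = pair_graph +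
  fixes S :: "'a set" and P :: "'a list" and s :: 'a
  assumes S_verts: "S \<subseteq> pverts G"
    and P_path: "list_path P"
    and s_uncovered: "s \<in> S - set P"
    and alpha_minimal: "list_path P' \<Longrightarrow> alpha (S - set P) \<le> alpha (S - set P')"
    and component_minimal:
      "list_path P' \<Longrightarrow> alpha (S - set P') = alpha (S - set P) \<Longrightarrow> s' \<in> S - set P' \<Longrightarrow>
        card (reach_in (pverts G - set P) `` {s}) \<le> card (reach_in (pverts G - set P') `` {s'})"
begin

definition D :: "'a set" where "D = reach_in (pverts G - set P) `` {s}"

text \<open>
  The points at which \<open>D\<close> is attached to \<open>P\<close>; since \<open>D\<close> is a component of \<open>G - P\<close>, they are all the
  neighbours that \<open>D\<close> has outside itself.
\<close>
definition U :: "'a set" where "U = {u \<in> set P. \<exists>d\<in>D. (d, u) \<in> parcs G}"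

definition A :: "'a set" where "A = S - set P - D"

lemma s_in_D: "s \<in> D"
  unfolding D_def by auto

lemma D_subset: "D \<subseteq> pverts G - set P"
  unfolding D_def using reach_in_mem s_uncovered S_verts by blast

lemma finite_D: "finite D"
  using D_subset pair_finite_verts by (meson finite_Diff finite_subset)

lemma neighbour_of_D: "d \<in> D \<Longrightarrow> (d, x) \<in> parcs G \<Longrightarrow> x \<in> D \<or> x \<in> U"
proof -
  assume d: "d \<in> D" and e: "(d, x) \<in> parcs G"
  show ?thesis
  proof (cases "x \<in> set P")
    case True
    then show ?thesis using d e unfolding U_def by blast
  next
    case False
    then have "(d, x) \<in> Restr (parcs G) (pverts G - set P)"
      using d e D_subset in_arcsD2 by auto
    then have "x \<in> D" using d unfolding D_def
      by (auto intro: rtrancl.rtrancl_into_rtrancl)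
    then show ?thesis ..
  qed
qed

lemma D_reach: "d \<in> D \<Longrightarrow> d' \<in> D \<Longrightarrow> (d, d') \<in> reach_in D"
proof -
  have *: "(s, x) \<in> reach_in D" if "(s, x) \<in> reach_in (pverts G - set P)" for x
    using that
  proof (induction rule: rtrancl_induct)
    case (step y z)
    have "y \<in> D" using step(1) unfolding D_def by auto
    moreover have "z \<in> D"
      using step(1,2) unfolding D_def by (auto intro: rtrancl.rtrancl_into_rtrancl)
    ultimately show ?case using step by (auto intro: rtrancl.rtrancl_into_rtrancl)
  qed simp
  assume "d \<in> D" "d' \<in> D"
  then have "(s, d) \<in> reach_in D" "(s, d') \<in> reach_in D" using * unfolding D_def by auto
  then show ?thesis using reach_in_sym rtrancl_trans by metis
qed

text \<open>
  A path that keeps all attachments still fences off \<open>D\<close>, so what it leaves of \<open>D\<close> falls apart into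
  components that are smaller than \<open>D\<close> as soon as the path meets \<open>D\<close>.
\<close>
lemma reach_avoiding_stays_in_D:
  assumes "U \<subseteq> set P'" "s' \<in> D - set P'"
  shows "reach_in (pverts G - set P') `` {s'} \<subseteq> D - set P'"
proof
  fix x assume "x \<in> reach_in (pverts G - set P') `` {s'}"
  then have "(s', x) \<in> reach_in (pverts G - set P')" by simp
  then show "x \<in> D - set P'"
  proof (induction rule: rtrancl_induct)
    case base
    then show ?case using assms by simp
  next
    case (step y z)
    then show ?case using neighbour_of_D[of y z] assms by auto
  qed
qed

lemma alpha_uncovered: "alpha (S - set P) = alpha A + alpha (S \<inter> D)"
proof -
  have "S - set P = A \<union> (S \<inter> D)" unfolding A_def using D_subset by auto
  moreover have "alpha (A \<union> (S \<inter> D)) = alpha A + alpha (S \<inter> D)"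
  proof (rule alpha_Un_disjoint)
    show "(y, z) \<notin> parcs G" if "y \<in> A" "z \<in> S \<inter> D" for y z
      using that neighbour_of_D[of z y] parcs_sym[of y z] unfolding A_def U_def by auto
  qed (auto simp: A_def)
  ultimately show ?thesis by simp
qed

text \<open>
  The only place where the extremal choice is used. Such a \<open>P'\<close> would be as good as \<open>P\<close>, since the
  vertices it gives up cost nothing. If it covered all of \<open>S \<inter> D\<close> it would be strictly better;
  otherwise a vertex of \<open>S\<close> left in \<open>D\<close> lies in a smaller component.
\<close>
lemma no_exchange:
  assumes P': "list_path P'" and U: "U \<subseteq> set P'" and D: "set P' \<inter> D \<noteq> {}"
    and drop: "alpha (A \<union> (S \<inter> (set P - set P'))) \<le> alpha A"
  shows False
proof -
  have "S - set P' \<subseteq> (A \<union> (S \<inter> (set P - set P'))) \<union> (S \<inter> (D - set P'))"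
    unfolding A_def by auto
  then have "alpha (S - set P') \<le> alpha ((A \<union> (S \<inter> (set P - set P'))) \<union> (S \<inter> (D - set P')))"
    by (rule alpha_mono)
  also have "\<dots> \<le> alpha (A \<union> (S \<inter> (set P - set P'))) + alpha (S \<inter> (D - set P'))"
    by (rule alpha_Un_le)
  finally have le: "alpha (S - set P') \<le> alpha A + alpha (S \<inter> (D - set P'))"
    using drop by simp
  have mono: "alpha (S \<inter> (D - set P')) \<le> alpha (S \<inter> D)" by (intro alpha_mono) auto
  have min: "alpha A + alpha (S \<inter> D) \<le> alpha (S - set P')"
    using alpha_minimal[OF P'] alpha_uncovered by simp
  have "1 \<le> alpha (S \<inter> D)"
    using alpha_pos[of s] s_in_D s_uncovered S_verts by auto
  have "S \<inter> (D - set P') \<noteq> {}"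
  proof
    assume "S \<inter> (D - set P') = {}"
    moreover have "alpha {} = 0"
      by (metis alpha_attained card.empty subset_empty)
    ultimately show False using le min \<open>1 \<le> alpha (S \<inter> D)\<close> by simp
  qed
  then obtain s' where s': "s' \<in> S" "s' \<in> D - set P'" by auto
  have "alpha (S - set P') = alpha (S - set P)"
    using le min mono alpha_uncovered by simp
  then have "card D \<le> card (reach_in (pverts G - set P') `` {s'})"
    using component_minimal[OF P'] s' unfolding D_def by blast
  also have "\<dots> \<le> card (D - set P')"
    using reach_avoiding_stays_in_D[OF U s'(2)] finite_D by (intro card_mono) auto
  also have "\<dots> < card D"
    using D finite_D by (intro psubset_card_mono) auto
  finally show False by simp
qed

text \<open>
  Both lists may be empty, so the same statement gives detours between two attachments and extensions
  of \<open>P\<close> beyond either of its ends.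
\<close>
lemma bridge_through_D:
  assumes "xs = [] \<or> last xs \<in> U" "ys = [] \<or> hd ys \<in> U"
  obtains zs where "zs \<noteq> []" "set zs \<subseteq> D" "list_path zs"
    "xs \<noteq> [] \<Longrightarrow> (last xs, hd zs) \<in> parcs G" "ys \<noteq> [] \<Longrightarrow> (last zs, hd ys) \<in> parcs G"
proof -
  obtain d where d: "d \<in> D" "xs \<noteq> [] \<Longrightarrow> (last xs, d) \<in> parcs G"
    using assms(1) s_in_D parcs_sym unfolding U_def by blast
  obtain d' where d': "d' \<in> D" "ys \<noteq> [] \<Longrightarrow> (d', hd ys) \<in> parcs G"
    using assms(2) s_in_D unfolding U_def by blast
  have "D \<subseteq> pverts G" using D_subset by auto
  with D_reach[OF d(1) d'(1)] d(1) obtain zs where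
    "list_path zs" "zs \<noteq> []" "hd zs = d" "last zs = d'" "set zs \<subseteq> D"
    using reach_in_path by metis
  then show thesis using that d d' by blast
qed

text \<open>The positions at which a gap starts: the front of \<open>P\<close> and the successors of the attachments.\<close>
definition starts :: "nat set" where
  "starts = {n. n \<le> length P \<and> (n = 0 \<or> P ! (n - 1) \<in> U)}"

lemma last_take_start: "n \<in> starts \<Longrightarrow> take n P = [] \<or> last (take n P) \<in> U"
  unfolding starts_def by (cases n) (auto simp: take_Suc_conv_app_nth)

lemma card_starts: "card starts = card U + 1" "finite starts"
proof -
  have dist: "distinct P" using P_path unfolding list_path_def by simp
  let ?I = "{i. i < length P \<and> P ! i \<in> U}"
  have st: "starts = insert 0 (Suc ` ?I)"
  proof (intro equalityI subsetI)
    fix n assume "n \<in> starts"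
    then show "n \<in> insert 0 (Suc ` ?I)" unfolding starts_def by (cases n) auto
  qed (auto simp: starts_def)
  have "bij_betw ((!) P) ?I U"
    unfolding bij_betw_def
  proof
    show "inj_on ((!) P) ?I"
      using dist by (auto simp: inj_on_def nth_eq_iff_index_eq)
    show "(!) P ` ?I = U"
      unfolding U_def by (auto simp: image_iff in_set_conv_nth)
  qed
  then have "card ?I = card U" by (rule bij_betw_same_card)
  moreover have fin: "finite ?I" by simp
  ultimately show "card starts = card U + 1" unfolding st
    by (subst card_insert_disjoint) (auto simp: card_image)
  show "finite starts" unfolding st using fin by simp
qed

text \<open>
  If a whole gap could be given up without raising \<open>\<alpha>(A)\<close>, a detour through \<open>D\<close> in its place would
  be a forbidden exchange. So \<open>\<alpha>(A)\<close> rises within the gap; \<open>e\<close> is the first position by which it has.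
\<close>
lemma rise_before_next_attachment:
  assumes n: "n \<in> starts"
  shows "\<exists>e>n. e \<le> length P \<and> slice_set P n e \<inter> U = {} \<and>
    alpha (A \<union> (S \<inter> slice_set P n (e - 1))) \<le> alpha A \<and>
    alpha A < alpha (A \<union> (S \<inter> slice_set P n e))"
proof -
  have path: "set P \<subseteq> pverts G" "distinct P" "successively (\<lambda>x y. (x, y) \<in> parcs G) P"
    using P_path unfolding list_path_def by auto
  have nle: "n \<le> length P" using n unfolding starts_def by simp
  \<comment> \<open>The gap ends at \<open>t\<close>: the next attachment, or the end of \<open>P\<close>.\<close>
  define t where "t = (LEAST t. n \<le> t \<and> (t < length P \<longrightarrow> P ! t \<in> U))"
  have t: "n \<le> t" "t < length P \<Longrightarrow> P ! t \<in> U"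
    using LeastI[of "\<lambda>t. n \<le> t \<and> (t < length P \<longrightarrow> P ! t \<in> U)" "length P"] nle
    unfolding t_def by auto
  have tle: "t \<le> length P"
    unfolding t_def by (rule Least_le) (use nle in auto)
  have tU: "slice_set P n t \<inter> U = {}"
  proof -
    have "P ! i \<notin> U" if "n \<le> i" "i < t" for i
      using not_less_Least[of i "\<lambda>t. n \<le> t \<and> (t < length P \<longrightarrow> P ! t \<in> U)"] that
      unfolding t_def by auto
    then show ?thesis unfolding slice_set_def by auto
  qed
  have rise: "alpha A < alpha (A \<union> (S \<inter> slice_set P n t))"
  proof (rule ccontr)
    assume not: "\<not> ?thesis"
    have "drop t P = [] \<or> hd (drop t P) \<in> U"
      using t(2) by (cases "t < length P") (auto simp: hd_drop_conv_nth)
    then obtain zs where zs: "zs \<noteq> []" "set zs \<subseteq> D" "list_path zs"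
      "take n P \<noteq> [] \<Longrightarrow> (last (take n P), hd zs) \<in> parcs G"
      "drop t P \<noteq> [] \<Longrightarrow> (last zs, hd (drop t P)) \<in> parcs G"
      using bridge_through_D[OF last_take_start[OF n]] by metis
    define P' where "P' = take n P @ zs @ drop t P"
    have setP: "set P = slice_set P 0 n \<union> slice_set P n t \<union> slice_set P t (length P)"
      using slice_set_Un[of 0 n t P] slice_set_Un[of 0 t "length P" P] t(1) tle
        set_take_slice[of "length P" P] by auto
    have setP': "set P' = slice_set P 0 n \<union> set zs \<union> slice_set P t (length P)"
      unfolding P'_def using nle by (auto simp: set_take_slice set_drop_slice)
    show False
    proof (rule no_exchange)
      show "list_path P'"
        unfolding list_path_def
      proof (intro conjI)
        show "set P' \<subseteq> pverts G"
          using path(1) zs(2) D_subset setP unfolding setP' by auto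
        have "set (take n P) \<inter> set (drop t P) = {}"
          using path(2) t(1) by (simp add: set_take_disj_set_drop_if_distinct)
        moreover have "set zs \<inter> set P = {}" using zs(2) D_subset by auto
        ultimately show "distinct P'"
          unfolding P'_def using path(2) zs(3)
          by (auto simp: list_path_def dest: in_set_takeD in_set_dropD)
        have "successively (\<lambda>x y. (x, y) \<in> parcs G) (take n P)"
          "successively (\<lambda>x y. (x, y) \<in> parcs G) (drop t P)"
          using path(3) by (metis append_take_drop_id successively_append_iff)+
        then show "successively (\<lambda>x y. (x, y) \<in> parcs G) P'"
          unfolding P'_def using zs by (auto simp: list_path_def successively_append_iff)
      qed
      show "U \<subseteq> set P'" using tU setP unfolding setP' U_def by blast
      show "set P' \<inter> D \<noteq> {}" using zs(1,2) unfolding setP' by (cases zs) auto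
      have "alpha (A \<union> (S \<inter> (set P - set P'))) \<le> alpha (A \<union> (S \<inter> slice_set P n t))"
        using setP setP' by (intro alpha_mono) auto
      then show "alpha (A \<union> (S \<inter> (set P - set P'))) \<le> alpha A" using not by simp
    qed
  qed
  define e where "e = (LEAST e. alpha A < alpha (A \<union> (S \<inter> slice_set P n e)))"
  have e: "alpha A < alpha (A \<union> (S \<inter> slice_set P n e))"
    unfolding e_def using rise by (rule LeastI)
  have et: "e \<le> t" unfolding e_def using rise by (rule Least_le)
  have "n < e"
  proof (rule ccontr)
    assume "\<not> n < e"
    then have "slice_set P n e = {}" by (simp add: slice_set_def)
    then show False using e by simp
  qed
  moreover have "alpha (A \<union> (S \<inter> slice_set P n (e - 1))) \<le> alpha A"
    using not_less_Least[of "e - 1" "\<lambda>e. alpha A < alpha (A \<union> (S \<inter> slice_set P n e))"] \<open>n < e\<close>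
    unfolding e_def by (simp add: not_less)
  moreover have "slice_set P n e \<inter> U = {}"
    using tU slice_set_mono[of n n e t P] et by blast
  ultimately show ?thesis using e et tle by auto
qed

end

context minimal_path
begin

text \<open>
  The Chvatal-Erdos rerouting: follow \<open>P\<close> to the start \<open>n\<close> of the first gap, pass through \<open>D\<close> to the
  attachment just before the second gap, run back along \<open>P\<close> to position \<open>i\<close>, cross the link to
  position \<open>i'\<close>, and follow \<open>P\<close> to its end. Only the two stretches before \<open>i\<close> and \<open>i'\<close> in their gaps
  are lost. For \<open>n = 0\<close> the new path starts in \<open>D\<close>.
\<close>
lemma splice_along_link:
  assumes n: "n \<in> starts" and n': "n' \<in> starts"
    and ord: "n \<le> i" "i < n'" "n' \<le> i'" "i' < length P"
    and lk: "linked A (P ! i) (P ! i')"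
  obtains P' where "list_path P'" "set P' \<inter> D \<noteq> {}"
    "set P - set P' \<subseteq> slice_set P n i \<union> slice_set P n' i'"
proof -
  let ?adj = "\<lambda>x y. (x, y) \<in> parcs G"
  have path: "set P \<subseteq> pverts G" "distinct P" "successively ?adj P"
    using P_path unfolding list_path_def by auto
  define L where "L = take n P"
  define M where "M = take (i - n) (drop n P)"
  define K where "K = take (n' - i) (drop i P)"
  define N where "N = take (i' - n') (drop n' P)"
  define R where "R = drop i' P"
  \<comment> \<open>\<open>M\<close> and \<open>N\<close> are the stretches given up; \<open>K\<close> is traversed backwards.\<close>
  have split: "P = L @ M @ K @ N @ R"
  proof -
    have "P = take n P @ drop n P" by simp
    also have "drop n P = M @ drop i P"
      unfolding M_def using append_take_drop_id[of "i - n" "drop n P"] ord by simp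
    also have "drop i P = K @ drop n' P"
      unfolding K_def using append_take_drop_id[of "n' - i" "drop i P"] ord by simp
    also have "drop n' P = N @ R"
      unfolding N_def R_def using append_take_drop_id[of "i' - n'" "drop n' P"] ord by simp
    finally show ?thesis unfolding L_def by simp
  qed
  have len: "length L = n" "length M = i - n" "length K = n' - i" "length N = i' - n'"
    unfolding L_def M_def K_def N_def using ord by auto
  have ne: "K \<noteq> []" "R \<noteq> []" using len ord unfolding R_def by auto
  have hdK: "hd K = P ! i" and hdR: "hd R = P ! i'"
    unfolding K_def R_def using ord by (auto simp: hd_drop_conv_nth hd_take)
  have lastK: "last K = P ! (n' - 1)"
    using ne len ord unfolding K_def by (simp add: last_conv_nth min_absorb2)
  have M: "set M = slice_set P n i"
  proof -
    have "M = drop n (take i P)" unfolding M_def by (simp add: drop_take)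
    then show ?thesis using ord by (auto simp: set_drop_slice slice_set_def)
  qed
  have N: "set N = slice_set P n' i'"
  proof -
    have "N = drop n' (take i' P)" unfolding N_def by (simp add: drop_take)
    then show ?thesis using ord by (auto simp: set_drop_slice slice_set_def)
  qed
  have "hd (rev K) \<in> U"
    using n' ne lastK ord unfolding starts_def by (auto simp: hd_rev)
  then obtain zs where zs: "zs \<noteq> []" "set zs \<subseteq> D" "list_path zs"
    "L \<noteq> [] \<Longrightarrow> (last L, hd zs) \<in> parcs G" "(last zs, hd (rev K)) \<in> parcs G"
    using bridge_through_D[of L "rev K"] last_take_start[OF n] ne unfolding L_def by auto
  have AV: "A \<subseteq> pverts G" unfolding A_def using S_verts by auto
  obtain xs where xs: "set xs \<subseteq> A" "distinct xs" "successively ?adj (hd K # xs @ [hd R])"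
    using linked_path[OF lk AV] unfolding hdK hdR by blast
  define P' where "P' = L @ zs @ rev K @ xs @ R"
  have sub: "successively ?adj L" "successively ?adj K" "successively ?adj R"
    using path(3) by (subst (asm) split, simp add: successively_append_iff)+
  have revK: "successively ?adj (rev K)"
    using sub(2) parcs_sym by (simp add: successively_rev)
  have disj: "set zs \<inter> set P = {}" "set xs \<inter> set P = {}" "set zs \<inter> set xs = {}"
    using zs(2) D_subset xs(1) unfolding A_def by auto
  have "list_path P'"
    unfolding list_path_def
  proof (intro conjI)
    have "set P' \<subseteq> set P \<union> set zs \<union> set xs" unfolding P'_def by (subst split) auto
    then show "set P' \<subseteq> pverts G" using path(1) zs(2) D_subset xs(1) AV by blast
    have "distinct (L @ M @ K @ N @ R)" using path(2) split by simp
    moreover have "set P = set L \<union> set M \<union> set K \<union> set N \<union> set R" by (subst split) auto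
    ultimately show "distinct P'"
      using disj zs(3) xs(2) unfolding P'_def by (auto simp: list_path_def)
    have "successively ?adj (rev K @ xs @ R)"
      using xs(3) revK sub(3) ne
      by (auto simp: successively_append_iff successively_Cons last_rev hd_append)
    then show "successively ?adj P'"
      unfolding P'_def using zs sub(1) ne by (auto simp: list_path_def successively_append_iff)
  qed
  moreover have "set P' \<inter> D \<noteq> {}" unfolding P'_def using zs(1,2) by (cases zs) auto
  moreover have "set P - set P' \<subseteq> slice_set P n i \<union> slice_set P n' i'"
    unfolding P'_def M[symmetric] N[symmetric] by (subst split) auto
  ultimately show thesis using that by blast
qed

text \<open>
  Rerouting along a link is a forbidden exchange provided that the two lost stretches together do not
  raise \<open>\<alpha>(A)\<close>. Each of them alone does not, being a proper part of its segment; a link with \<open>i + i'\<close>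
  minimal ensures that they are not linked to each other, and then neither does their union.
\<close>
lemma segments_unlinked:
  assumes n: "n \<in> starts" and n': "n' \<in> starts" and ord: "e \<le> n'" "e' \<le> length P"
    and U: "slice_set P n e \<inter> U = {}" "slice_set P n' e' \<inter> U = {}"
    and drop: "alpha (A \<union> (S \<inter> slice_set P n (e - 1))) \<le> alpha A"
      "alpha (A \<union> (S \<inter> slice_set P n' (e' - 1))) \<le> alpha A"
    and y: "y \<in> S \<inter> slice_set P n e" and y': "y' \<in> S \<inter> slice_set P n' e'"
  shows "\<not> linked A y y'"
proof
  assume "linked A y y'"
  let ?Q = "\<lambda>i i'. i \<in> {n..<e} \<and> i' \<in> {n'..<e'} \<and> P ! i \<in> S \<and> P ! i' \<in> S \<and> linked A (P ! i) (P ! i')"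
  have "\<exists>m i i'. m = i + i' \<and> ?Q i i'"
  proof -
    from y y' obtain i i' where "y = P ! i" "i \<in> {n..<e}" "y' = P ! i'" "i' \<in> {n'..<e'}"
      unfolding slice_set_def by auto
    then show ?thesis using \<open>linked A y y'\<close> y y' by (intro exI[of _ "i + i'"] exI[of _ i] exI[of _ i']) auto
  qed
  then have "\<exists>m. (\<exists>i i'. m = i + i' \<and> ?Q i i') \<and> (\<forall>l<m. \<not> (\<exists>i i'. l = i + i' \<and> ?Q i i'))"
    by (rule exists_least_iff[THEN iffD1])
  then obtain i i' where Q: "?Q i i'" and least: "\<And>j j'. j + j' < i + i' \<Longrightarrow> \<not> ?Q j j'"
    by metis
  have "distinct P" using P_path unfolding list_path_def by simp
  have o: "n \<le> i" "i < e" "i < n'" "n' \<le> i'" "i' < e'" "i' < length P" using Q ord by auto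
  obtain P' where P': "list_path P'" "set P' \<inter> D \<noteq> {}"
    "set P - set P' \<subseteq> slice_set P n i \<union> slice_set P n' i'"
    using splice_along_link[OF n n' o(1,3,4,6)] Q by blast
  let ?Z = "S \<inter> slice_set P n i" and ?Z' = "S \<inter> slice_set P n' i'"
  have le: "alpha (A \<union> ?Z) \<le> alpha A" "alpha (A \<union> ?Z') \<le> alpha A"
    using drop alpha_mono[of "A \<union> ?Z" "A \<union> (S \<inter> slice_set P n (e - 1))"]
      alpha_mono[of "A \<union> ?Z'" "A \<union> (S \<inter> slice_set P n' (e' - 1))"]
      slice_set_mono[of n n i "e - 1" P] slice_set_mono[of n' n' i' "e' - 1" P] o
    by fastforce+
  have "slice_set P n i \<subseteq> set P" "slice_set P n' i' \<subseteq> set P"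
    using o by (auto intro!: slice_set_subset)
  moreover have "slice_set P n i \<inter> slice_set P n' i' = {}"
    using o \<open>distinct P\<close> by (intro slice_set_disjoint) auto
  moreover have "\<not> linked A z z'" if zz: "z \<in> ?Z" "z' \<in> ?Z'" for z z'
  proof -
    obtain j where "z = P ! j" "n \<le> j" "j < i"
      using zz(1) unfolding slice_set_def by auto
    moreover obtain j' where "z' = P ! j'" "n' \<le> j'" "j' < i'"
      using zz(2) unfolding slice_set_def by auto
    ultimately show ?thesis using least[of j j'] zz o by auto
  qed
  ultimately have "alpha (A \<union> ?Z \<union> ?Z') + alpha A = alpha (A \<union> ?Z) + alpha (A \<union> ?Z')"
    unfolding A_def by (intro alpha_Un_unlinked) (auto simp: A_def)
  then have "alpha (A \<union> ?Z \<union> ?Z') \<le> alpha A" using le by simp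
  moreover have "alpha (A \<union> (S \<inter> (set P - set P'))) \<le> alpha (A \<union> ?Z \<union> ?Z')"
    using P'(3) by (intro alpha_mono) auto
  moreover have "U \<subseteq> set P'"
  proof
    fix u assume u: "u \<in> U"
    have "u \<notin> slice_set P n i" "u \<notin> slice_set P n' i'"
      using u U slice_set_mono[of n n i e P] slice_set_mono[of n' n' i' e' P] o by auto
    then show "u \<in> set P'" using u P'(3) unfolding U_def by auto
  qed
  ultimately show False using no_exchange[OF P'(1) _ P'(2)] order_trans by blast
qed

text \<open>
  The gain in the independence number: every one of the \<open>card U + 1\<close> segments contributes one, and \<open>D\<close>
  contributes separately because it has no neighbour in \<open>A\<close> or in a segment. The second claim supplies
  a vertex of \<open>S\<close> that \<open>U\<close> separates from \<open>s\<close>.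
\<close>
lemma alpha_ge_attachments:
  shows "alpha (S - set P) + card U + 1 \<le> alpha S"
    and "\<exists>x\<in>S \<inter> set P. x \<notin> U"
proof -
  obtain E where E: "\<And>n. n \<in> starts \<Longrightarrow> n < E n \<and> E n \<le> length P \<and> slice_set P n (E n) \<inter> U = {} \<and>
    alpha (A \<union> (S \<inter> slice_set P n (E n - 1))) \<le> alpha A \<and>
    alpha A < alpha (A \<union> (S \<inter> slice_set P n (E n)))"
    using rise_before_next_attachment by metis
  have dist: "distinct P" using P_path unfolding list_path_def by simp
  let ?B = "\<lambda>n. S \<inter> slice_set P n (E n)"
  have BP: "?B n \<subseteq> set P" if "n \<in> starts" for n
    using slice_set_subset[of "E n" P n] E[OF that] by auto
  have E_le: "E n \<le> n'" if "n \<in> starts" "n' \<in> starts" "n < n'" for n n'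
  proof (rule ccontr)
    assume "\<not> E n \<le> n'"
    then have "P ! (n' - 1) \<in> slice_set P n (E n)"
      using that unfolding slice_set_def by (intro imageI) auto
    moreover have "P ! (n' - 1) \<in> U" using that unfolding starts_def by auto
    ultimately show False using E that by blast
  qed
  have disj: "?B n \<inter> ?B n' = {}" if "n \<in> starts" "n' \<in> starts" "n \<noteq> n'" for n n'
  proof -
    have "E n \<le> n' \<or> E n' \<le> n" using that E_le[of n n'] E_le[of n' n] by linarith
    then have "slice_set P n (E n) \<inter> slice_set P n' (E n') = {}"
      using slice_set_disjoint[OF dist] E that by blast
    then show ?thesis by auto
  qed
  have unl: "\<not> linked A y y'" if n: "n \<in> starts" "n' \<in> starts" "n \<noteq> n'" and y: "y \<in> ?B n" "y' \<in> ?B n'"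
    for n n' y y'
  proof (cases "n < n'")
    case True
    then show ?thesis
      using segments_unlinked[OF n(1,2) E_le[OF n(1,2) True], of "E n'"] E[OF n(1)] E[OF n(2)] y
      by blast
  next
    case False
    then have "n' < n" using n by simp
    then have "\<not> linked A y' y"
      using segments_unlinked[OF n(2,1) E_le[OF n(2,1)], of "E n"] E[OF n(1)] E[OF n(2)] y
      by blast
    then show ?thesis using linked_sym by blast
  qed
  have sum: "alpha A + card J \<le> alpha (A \<union> (\<Union>n\<in>J. ?B n))" if "J \<subseteq> starts" for J
  proof -
    have "finite J" using that card_starts(2) finite_subset by blast
    then show ?thesis using that
    proof (induction J rule: finite_induct)
      case (insert n J)
      then have n: "n \<in> starts" "J \<subseteq> starts" "n \<notin> J" by auto
      have "alpha (A \<union> ?B n \<union> (\<Union>n\<in>J. ?B n)) + alpha A =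
          alpha (A \<union> ?B n) + alpha (A \<union> (\<Union>n\<in>J. ?B n))"
      proof (rule alpha_Un_unlinked)
        show "A \<inter> ?B n = {}" "A \<inter> (\<Union>n\<in>J. ?B n) = {}"
          using BP n unfolding A_def by blast+
        show "?B n \<inter> (\<Union>n\<in>J. ?B n) = {}" using disj n by blast
        show "\<not> linked A z z'" if "z \<in> ?B n" "z' \<in> (\<Union>n\<in>J. ?B n)" for z z'
          using that unl n by blast
      qed
      moreover have "alpha A < alpha (A \<union> ?B n)" using E[OF n(1)] by simp
      ultimately have "alpha A + card (insert n J) \<le> alpha (A \<union> ?B n \<union> (\<Union>n\<in>J. ?B n))"
        using insert by simp
      then show ?case by (simp add: Un_assoc)
    qed simp
  qed
  let ?W = "A \<union> (\<Union>n\<in>starts. ?B n)"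
  have WD: "?W \<inter> D = {}" using BP D_subset unfolding A_def by fastforce
  have "alpha (?W \<union> (S \<inter> D)) = alpha ?W + alpha (S \<inter> D)"
  proof (rule alpha_Un_disjoint)
    show "?W \<inter> (S \<inter> D) = {}" using WD by auto
    show "(y, z) \<notin> parcs G" if y: "y \<in> ?W" and z: "z \<in> S \<inter> D" for y z
    proof
      assume "(y, z) \<in> parcs G"
      then have "(z, y) \<in> parcs G" using parcs_sym by blast
      then have "y \<in> D \<or> y \<in> U" using neighbour_of_D z by auto
      moreover have "y \<notin> D" using y WD by auto
      moreover have "y \<notin> U"
      proof -
        have "A \<inter> U = {}" unfolding A_def U_def by auto
        moreover have "?B n \<inter> U = {}" if "n \<in> starts" for n using E[OF that] by auto
        ultimately show ?thesis using y by auto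
      qed
      ultimately show False by simp
    qed
  qed
  moreover have "?W \<union> (S \<inter> D) \<subseteq> S" unfolding A_def by auto
  ultimately have "alpha ?W + alpha (S \<inter> D) \<le> alpha S" using alpha_mono by metis
  then show "alpha (S - set P) + card U + 1 \<le> alpha S"
    using sum[of starts] card_starts(1) alpha_uncovered by simp
  have 0: "0 \<in> starts" unfolding starts_def by simp
  have "?B 0 \<noteq> {}" using E[OF 0] by (metis Un_empty_right less_irrefl)
  then obtain x where "x \<in> ?B 0" by blast
  then show "\<exists>x\<in>S \<inter> set P. x \<notin> U" using E[OF 0] BP[OF 0] by auto
qed

end

context pair_graph
begin

section \<open>Separators bound the connectivity\<close>
lemma card_separator_ge_local_connectivity:
  assumes "s \<in> D" "x \<notin> D" "x \<notin> U" "finite U"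
    and sep: "\<And>d y. d \<in> D \<Longrightarrow> (d, y) \<in> parcs G \<Longrightarrow> y \<in> D \<or> y \<in> U"
  shows "local_connectivity G s x \<le> card U"
proof -
  have meets: "set (inner_verts p) \<inter> U \<noteq> {}" if "awalk d p x" "d \<in> D" for d p
    using that
  proof (induction p arbitrary: d)
    case Nil
    then show ?case using assms(2) by (auto simp: awalk_def)
  next
    case (Cons e p)
    obtain y where e: "e = (d, y)" "(d, y) \<in> parcs G" "awalk y p x"
      using Cons.prems(1) by (cases e) (auto simp: awalk_Cons_iff)
    have y: "y \<in> D \<or> y \<in> U" using sep Cons.prems(2) e(2) by blast
    have "p \<noteq> []" using y e(3) assms(2,3) by (auto simp: awalk_def)
    then have "inner_verts (e # p) = y # inner_verts p"
      using e(3) by (cases p) (auto simp: inner_verts_def awalk_Cons_iff)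
    then show ?case using y Cons.IH[OF e(3)] by auto
  qed
  have bound: "card F \<le> card U" if F: "internally_disjoint_paths G s x F" for F
  proof -
    have ap: "apath s p x" if "p \<in> F" for p
      using F that unfolding internally_disjoint_paths_def by auto
    have dj: "set (inner_verts p) \<inter> set (inner_verts q) = {}" if "p \<in> F" "q \<in> F" "p \<noteq> q" for p q
      using F that unfolding internally_disjoint_paths_def pairwise_def by auto
    have "\<forall>p\<in>F. \<exists>u. u \<in> set (inner_verts p) \<and> u \<in> U"
      using meets[OF awalkI_apath[OF ap] assms(1)] by blast
    then obtain f where f: "\<And>p. p \<in> F \<Longrightarrow> f p \<in> set (inner_verts p) \<and> f p \<in> U" by metis
    have "inj_on f F"
    proof (rule inj_onI, rule ccontr)
      fix p q assume pq: "p \<in> F" "q \<in> F" "f p = f q" "p \<noteq> q"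
      then have "f p \<in> set (inner_verts p) \<inter> set (inner_verts q)"
        using f[of p] f[of q] by simp
      then show False using dj[OF pq(1,2,4)] by simp
    qed
    then show ?thesis using f assms(4) card_inj_on_le[of f F U] by auto
  qed
  have "local_connectivity G s x \<in> {card F | F. internally_disjoint_paths G s x F}"
    unfolding local_connectivity_def
  proof (rule Max_in)
    have "{card F | F. internally_disjoint_paths G s x F} \<subseteq> {..card U}" using bound by auto
    then show "finite {card F | F. internally_disjoint_paths G s x F}"
      using finite_subset by blast
    show "{card F | F. internally_disjoint_paths G s x F} \<noteq> {}"
      by (auto simp: internally_disjoint_paths_def intro!: exI[of _ "{}"])
  qed
  then show ?thesis using bound by auto
qed

lemma connectivity_on_le:
  assumes "S \<subseteq> pverts G" "x \<in> S" "y \<in> S" "x \<noteq> y"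
  shows "connectivity_on G S \<le> enat (local_connectivity G x y)"
proof -
  have "finite S" using assms(1) pair_finite_verts finite_subset by blast
  have "card {x, y} \<le> card S" using assms \<open>finite S\<close> by (intro card_mono) auto
  then have "2 \<le> card S" using assms by simp
  have "{local_connectivity G x y | x y. x \<in> S \<and> y \<in> S \<and> x \<noteq> y} \<subseteq>
      (\<lambda>(x, y). local_connectivity G x y) ` (S \<times> S)" by auto
  then have "finite {local_connectivity G x y | x y. x \<in> S \<and> y \<in> S \<and> x \<noteq> y}"
    using \<open>finite S\<close> by (meson finite_SigmaI finite_imageI finite_subset)
  then show ?thesis
    unfolding connectivity_on_def using \<open>2 \<le> card S\<close> assms
    by (auto intro!: Min_le)
qed

text \<open>
  For the extremal path, \<open>U\<close> separates \<open>s\<close> from a vertex of \<open>S\<close> on the path, so the connectivity of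
  \<open>S\<close> is a lower bound for the \<open>card U\<close> in \<open>alpha_ge_attachments\<close>. If the connectivity is infinite, there are
  no two vertices to separate; then \<open>S\<close> has at most one vertex and a path contains it.
\<close>
lemma path_dropping_alpha:
  assumes S: "S \<subseteq> pverts G"
  obtains P where "list_path P"
    "S \<subseteq> set P \<or> enat (alpha (S - set P)) + connectivity_on G S + 1 \<le> enat (alpha S)"
proof -
  let ?a = "\<lambda>P. alpha (S - set P)"
  have "list_path []" by (simp add: list_path_def)
  then obtain P0 where P0: "list_path P0" "\<And>P'. list_path P' \<Longrightarrow> ?a P0 \<le> ?a P'"
    using ex_has_least_nat[of list_path "[]" ?a] by blast
  show thesis
  proof (cases "\<exists>P. list_path P \<and> ?a P = ?a P0 \<and> S \<subseteq> set P")
    case True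
    then show thesis using that by blast
  next
    case False
    let ?ok = "\<lambda>(P, s). list_path P \<and> ?a P = ?a P0 \<and> s \<in> S - set P"
    let ?size = "\<lambda>(P, s). card (reach_in (pverts G - set P) `` {s})"
    obtain s0 where "?ok (P0, s0)" using False P0(1) by auto
    then obtain z where z: "?ok z" "\<And>z'. ?ok z' \<Longrightarrow> ?size z \<le> ?size z'"
      using ex_has_least_nat[of ?ok "(P0, s0)" ?size] by blast
    obtain P s where Ps: "z = (P, s)" by (cases z)
    have P: "list_path P" "?a P = ?a P0" "s \<in> S - set P" using z(1) Ps by auto
    interpret minimal_path G S P s
    proof
      show "?a P \<le> ?a P'" if "list_path P'" for P' using P0(2)[OF that] P by simp
      show "card (reach_in (pverts G - set P) `` {s}) \<le> card (reach_in (pverts G - set P') `` {s'})"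
        if "list_path P'" "?a P' = ?a P" "s' \<in> S - set P'" for P' s'
        using z(2)[of "(P', s')"] that P Ps by auto
    qed (use S P in auto)
    obtain x where x: "x \<in> S" "x \<in> set P" "x \<notin> U" using alpha_ge_attachments(2) by auto
    have "x \<notin> D" "s \<noteq> x" using x D_subset s_uncovered by auto
    have "finite U" unfolding U_def by simp
    have "connectivity_on G S \<le> enat (local_connectivity G s x)"
      using connectivity_on_le[OF S] P(3) x \<open>s \<noteq> x\<close> by auto
    also have "\<dots> \<le> enat (card U)"
      using card_separator_ge_local_connectivity[OF s_in_D \<open>x \<notin> D\<close> x(3) \<open>finite U\<close> neighbour_of_D]
      by simp
    finally have "enat (?a P) + connectivity_on G S + 1 \<le> enat (?a P) + enat (card U) + 1"
      by (intro add_mono order_refl)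
    also have "\<dots> = enat (?a P + card U + 1)" by (simp add: one_enat_def)
    also have "\<dots> \<le> enat (alpha S)" using alpha_ge_attachments(1) by simp
    finally show thesis using that P by blast
  qed
qed

end

section \<open>Trees built by adding leaves\<close>
definition add_leaf :: "'a pair_pre_digraph \<Rightarrow> 'a \<Rightarrow> 'a \<Rightarrow> 'a pair_pre_digraph" where
  "add_leaf T t w = \<lparr>pverts = insert w (pverts T), parcs = {(t, w), (w, t)} \<union> parcs T\<rparr>"

lemma add_leaf_simps [simp]:
  "pverts (add_leaf T t w) = insert w (pverts T)"
  "parcs (add_leaf T t w) = {(t, w), (w, t)} \<union> parcs T"
  by (simp_all add: add_leaf_def)

lemma (in pair_graph) connected_iff_rtrancl:
  "Digraph_Component.connected (with_proj G) \<longleftrightarrow>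
     pverts G \<noteq> {} \<and> (\<forall>u\<in>pverts G. \<forall>v\<in>pverts G. (u, v) \<in> (parcs G)\<^sup>*)"
proof -
  have "mk_symmetric (with_proj G) = G"
    by (rule pair_pre_digraph.equality)
      (use parcs_sym in \<open>auto simp: mk_symmetric_def\<close>)
  then show ?thesis
    by (auto simp: connected_def strongly_connected_def reachable_conv')
qed

lemma pair_graph_add_leaf:
  assumes "pair_graph T" "t \<in> pverts T" "w \<notin> pverts T"
  shows "pair_graph (add_leaf T t w)"
proof -
  interpret T: pair_graph T by fact
  show ?thesis
    using assms(2,3) T.pair_finite_verts T.pair_finite_arcs T.parcs_sym
    by unfold_locales (auto simp: symmetric_def intro!: symI
      dest: T.in_arcsD1 T.in_arcsD2 T.no_loops')
qed

lemma (in wf_digraph) awalk_append_middle: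
  "awalk u (p @ q) v \<longleftrightarrow> (\<exists>x. awalk u p x \<and> awalk x q v)"
proof (induction p arbitrary: u)
  case Nil
  then show ?case by (auto simp: awalk_Nil_iff awalk_def)
next
  case (Cons e p)
  then show ?case by (simp add: awalk_Cons_iff)
qed

text \<open>
  A closed walk can visit the new leaf \<open>w\<close> only through \<open>(t, w)\<close> and \<open>(w, t)\<close>. Rotated to start at \<open>w\<close>,
  it begins with \<open>(w, t)\<close> and ends with \<open>(t, w)\<close>; since its heads are distinct, nothing fits in between.
  So a cycle of length at least 3 avoids \<open>w\<close>.
\<close>
lemma cycle_add_leaf:
  assumes "pair_graph T" "t \<in> pverts T" "w \<notin> pverts T"
    and c: "pre_digraph.cycle (with_proj (add_leaf T t w)) c" "3 \<le> length c"
  shows "pre_digraph.cycle (with_proj T) c"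
proof -
  interpret T: pair_graph T by fact
  interpret T': pair_graph "add_leaf T t w" by (rule pair_graph_add_leaf) fact+
  have tw: "t \<noteq> w" using assms by auto
  have arcs: "fst a \<noteq> w \<and> snd a \<noteq> w" if "a \<in> parcs T" for a
    using that T.arc_fst_in_verts T.arc_snd_in_verts assms(3) by metis
  have from_leaf: False if q: "T'.awalk w q w" "distinct (map snd q)" "3 \<le> length q" for q
  proof -
    obtain e1 q1 where q1: "q = e1 # q1" using q(3) by (cases q) auto
    have *: "e1 \<in> parcs (add_leaf T t w)" "fst e1 = w" "T'.awalk (snd e1) q1 w"
      using q(1) unfolding q1 T'.awalk_Cons_iff by auto
    then have "e1 = (t, w) \<or> e1 = (w, t) \<or> e1 \<in> parcs T" by simp
    then have "e1 = (w, t)" using *(2) arcs[of e1] tw by (metis fst_conv)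
    then have e1: "e1 = (w, t)" "T'.awalk t q1 w" using *(3) by simp_all
    have "q1 \<noteq> []" using e1(2) tw by (auto simp: T'.awalk_Nil_iff)
    then obtain q2 e2 where q2: "q1 = q2 @ [e2]" by (cases q1 rule: rev_cases) auto
    then obtain x where x: "T'.awalk t q2 x" "T'.awalk x [e2] w"
      using e1(2) T'.awalk_append_middle by blast
    then have **: "e2 \<in> parcs (add_leaf T t w)" "snd e2 = w" "x = fst e2"
      by (auto simp: T'.awalk_Cons_iff T'.awalk_Nil_iff)
    then have "e2 = (t, w) \<or> e2 = (w, t) \<or> e2 \<in> parcs T" by simp
    then have "e2 = (t, w)" using **(2) arcs[of e2] tw by (metis snd_conv)
    with ** have e2: "e2 = (t, w)" "x = t" by simp_all
    have "q2 = []"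
    proof (rule ccontr)
      assume "q2 \<noteq> []"
      then obtain q3 e3 where q3: "q2 = q3 @ [e3]" by (cases q2 rule: rev_cases) auto
      then obtain y where "T'.awalk y [e3] t"
        using x(1) T'.awalk_append_middle unfolding e2 by blast
      then have "snd e3 = t" by (auto simp: T'.awalk_Cons_iff T'.awalk_Nil_iff)
      then show False using q(2) unfolding q1 q2 q3 e1 by simp
    qed
    then show False using q(3) unfolding q1 q2 by simp
  qed
  obtain u where u: "T'.awalk u c u" "distinct (tl (pawalk_verts u c))" "c \<noteq> []"
    using c(1) unfolding T'.cycle_def by auto
  have heads: "distinct (map snd c)"
    using u T'.awalk_verts_conv'[of u c u] by (auto simp: T'.awalk_def)
  have rotate: False if pq: "c = p @ q" "T'.awalk u p w" "T'.awalk w q u" for p q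
  proof (rule from_leaf)
    show "T'.awalk w (q @ p) w" using pq T'.awalk_append_middle by blast
    show "distinct (map snd (q @ p))" using heads pq(1) by auto
    show "3 \<le> length (q @ p)" using c(2) pq(1) by simp
  qed
  have "fst e \<noteq> w \<and> snd e \<noteq> w" if e: "e \<in> set c" for e
  proof -
    obtain p q where pq: "c = p @ [e] @ q" using e by (metis append_Cons append_Nil split_list)
    obtain x where x: "T'.awalk u p x" "T'.awalk x ([e] @ q) u"
      using u(1) unfolding pq T'.awalk_append_middle[of u p] by blast
    then obtain y where y: "T'.awalk x [e] y" "T'.awalk y q u"
      unfolding T'.awalk_append_middle[of x "[e]"] by blast
    then have xy: "x = fst e" "y = snd e"
      by (auto simp: T'.awalk_Cons_iff T'.awalk_Nil_iff)
    have "T'.awalk u (p @ [e]) y" using x(1) y(1) T'.awalk_append_middle by blast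
    then have "y \<noteq> w" using rotate[of "p @ [e]" q] y(2) pq by auto
    moreover have "x \<noteq> w" using rotate[of p "[e] @ q"] x pq by blast
    ultimately show ?thesis using xy by simp
  qed
  then have sub: "set c \<subseteq> parcs T"
    using u(1) by (fastforce simp: T'.awalk_def)
  obtain e c' where "c = e # c'" using u(3) by (cases c) auto
  then have "u \<in> pverts T"
    using u(1) sub T.arc_fst_in_verts by (auto simp: T'.awalk_Cons_iff)
  then have "T.awalk u c u" using u(1) sub by (auto simp: T'.awalk_def T.awalk_def)
  then show ?thesis using u unfolding T.cycle_def by auto
qed

lemma undirected_tree_add_leaf:
  assumes T: "undirected_tree T" and "t \<in> pverts T" "w \<notin> pverts T"
  shows "undirected_tree (add_leaf T t w)"
proof -
  interpret T: pair_graph T using T unfolding undirected_tree_def by simp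
  interpret T': pair_graph "add_leaf T t w"
    by (rule pair_graph_add_leaf) (use assms T.pair_graph in auto)
  have "\<not> (\<exists>c. T'.cycle c \<and> 3 \<le> length c)"
    using cycle_add_leaf[OF T.pair_graph assms(2,3)] T unfolding undirected_tree_def by blast
  moreover have "Digraph_Component.connected (with_proj (add_leaf T t w))"
    unfolding T'.connected_iff_rtrancl
  proof (intro conjI ballI)
    let ?R = "parcs (add_leaf T t w)"
    have mono: "(parcs T)\<^sup>* \<subseteq> ?R\<^sup>*" by (rule rtrancl_mono) auto
    have T_conn: "(x, y) \<in> ?R\<^sup>*" if "x \<in> pverts T" "y \<in> pverts T" for x y
      using T that mono unfolding undirected_tree_def T.connected_iff_rtrancl by blast
    have "(t, w) \<in> ?R\<^sup>*" "(w, t) \<in> ?R\<^sup>*" by auto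
    then have "(x, t) \<in> ?R\<^sup>* \<and> (t, x) \<in> ?R\<^sup>*" if "x \<in> pverts (add_leaf T t w)" for x
      using that T_conn assms(2) by auto
    then show "(x, y) \<in> ?R\<^sup>*"
      if "x \<in> pverts (add_leaf T t w)" "y \<in> pverts (add_leaf T t w)" for x y
      using that by (meson rtrancl_trans)
  qed simp
  ultimately show ?thesis using T'.pair_graph unfolding undirected_tree_def by blast
qed

lemma in_degree_add_leaf:
  assumes "pair_graph T" "t \<in> pverts T" "w \<notin> pverts T"
  shows "in_degree (with_proj (add_leaf T t w)) v =
    (if v = w then 1 else in_degree (with_proj T) v + (if v = t then 1 else 0))"
proof -
  interpret T: pair_graph T by fact
  have tw: "t \<noteq> w" using assms by auto
  have notw: "(x, w) \<notin> parcs T" "(w, x) \<notin> parcs T" for x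
    using assms(3) T.in_arcsD1 T.in_arcsD2 by auto
  have "in_arcs (with_proj (add_leaf T t w)) v =
    (if v = w then {(t, w)} else if v = t then insert (w, t) (in_arcs (with_proj T) v)
     else in_arcs (with_proj T) v)"
    using notw tw by (auto simp: in_arcs_def)
  moreover have "(w, t) \<notin> in_arcs (with_proj T) t" using notw by (auto simp: in_arcs_def)
  moreover have "finite (in_arcs (with_proj T) t)" using T.finite_in_arcs by simp
  ultimately show ?thesis by (auto simp: in_degree_def)
qed

lemma undirected_tree_singleton: "undirected_tree \<lparr>pverts = {v}, parcs = {}\<rparr>"
proof -
  interpret T: pair_graph "\<lparr>pverts = {v}, parcs = {}\<rparr>"
    by unfold_locales (auto simp: symmetric_def sym_def)
  have "\<not> T.cycle c" for c
    by (cases c) (auto simp: T.cycle_def T.awalk_Cons_iff)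
  then show ?thesis
    unfolding undirected_tree_def T.connected_iff_rtrancl
    using T.pair_graph by auto
qed

context pair_graph
begin

section \<open>Growing a tree to cover a set\<close>
definition subtree :: "'a pair_pre_digraph \<Rightarrow> bool" where
  "subtree T \<longleftrightarrow> subgraph (with_proj T) (with_proj G) \<and> undirected_tree T"

lemma subtree_verts: "subtree T \<Longrightarrow> pverts T \<subseteq> pverts G"
  unfolding subtree_def subgraph_def by simp

lemma subtree_finite: "subtree T \<Longrightarrow> finite (pverts T)"
  by (rule finite_subset[OF subtree_verts pair_finite_verts])

lemma subtree_add_leaf:
  assumes T: "subtree T" and "t \<in> pverts T" "w \<notin> pverts T" "(t, w) \<in> parcs G"
  shows "subtree (add_leaf T t w)"
  unfolding subtree_def
proof
  show tree: "undirected_tree (add_leaf T t w)"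
    by (rule undirected_tree_add_leaf) (use assms in \<open>simp_all add: subtree_def\<close>)
  interpret T': pair_graph "add_leaf T t w" using tree unfolding undirected_tree_def by simp
  show "subgraph (with_proj (add_leaf T t w)) (with_proj G)"
    using T assms(4) parcs_sym[of t w] in_arcsD2[of t w] wf_digraph T'.wf_digraph
    unfolding subtree_def subgraph_def compatible_def by simp
qed

lemma subtree_singleton: "v \<in> pverts G \<Longrightarrow> subtree \<lparr>pverts = {v}, parcs = {}\<rparr>"
proof -
  assume v: "v \<in> pverts G"
  interpret T: pair_graph "\<lparr>pverts = {v}, parcs = {}\<rparr>"
    using undirected_tree_singleton[of v] unfolding undirected_tree_def by blast
  show ?thesis
    using v undirected_tree_singleton wf_digraph T.wf_digraph
    unfolding subtree_def subgraph_def compatible_def by auto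
qed

text \<open>
  Inside the attached path the crude bound 2 suffices, since it already excludes branch vertices; so
  only the point of attachment can become one.
\<close>
lemma subtree_add_path:
  assumes "subtree T" "t \<in> pverts T" "list_path (t # q)" "set q \<inter> pverts T = {}"
  shows "\<exists>T'. subtree T' \<and> pverts T' = pverts T \<union> set q \<and>
    (\<forall>v. in_degree (with_proj T') v \<le>
       (if v \<in> set q then 2 else in_degree (with_proj T) v + (if v = t then 1 else 0)))"
  using assms
proof (induction q arbitrary: T t)
  case Nil
  then show ?case by (intro exI[of _ T]) auto
next
  case (Cons w q)
  let ?T = "add_leaf T t w"
  have edge: "(t, w) \<in> parcs G" and path: "list_path (w # q)" and w: "w \<notin> set q" "w \<noteq> t" "t \<notin> set q"
    using Cons.prems(3) by (auto simp: list_path_def successively_Cons)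
  have "w \<notin> pverts T" using Cons.prems(4) by auto
  have "pair_graph T" using Cons.prems(1) unfolding subtree_def undirected_tree_def by simp
  have "subtree ?T"
    using subtree_add_leaf Cons.prems(1,2) \<open>w \<notin> pverts T\<close> edge by blast
  moreover have "set q \<inter> pverts ?T = {}" using Cons.prems(4) w by auto
  ultimately obtain T' where T': "subtree T'" "pverts T' = pverts ?T \<union> set q"
    and deg: "\<And>v. in_degree (with_proj T') v \<le>
       (if v \<in> set q then 2 else in_degree (with_proj ?T) v + (if v = w then 1 else 0))"
    using Cons.IH[of ?T w] path by auto
  have "in_degree (with_proj T') v \<le>
       (if v \<in> set (w # q) then 2 else in_degree (with_proj T) v + (if v = t then 1 else 0))" for v
    using deg[of v] w
      in_degree_add_leaf[OF \<open>pair_graph T\<close> Cons.prems(2) \<open>w \<notin> pverts T\<close>, of v]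
    by (auto split: if_splits)
  then show ?case using T' by (intro exI[of _ T']) auto
qed

end

context pair_graph
begin

lemma path_out_of_subtree:
  assumes conn: "Digraph_Component.connected (with_proj G)" and T: "subtree T"
    and x: "x \<in> pverts G - pverts T"
  obtains t q where "t \<in> pverts T" "list_path (t # q)" "q \<noteq> []" "last q = x" "set q \<inter> pverts T = {}"
proof -
  interpret T: pair_graph T using T unfolding subtree_def undirected_tree_def by simp
  obtain a where a: "a \<in> pverts T"
    using T unfolding subtree_def undirected_tree_def T.connected_iff_rtrancl by auto
  then have aG: "a \<in> pverts G" using subtree_verts[OF T] by auto
  have "Restr (parcs G) (pverts G) = parcs G" using in_arcsD1 in_arcsD2 by auto
  then have "(a, x) \<in> reach_in (pverts G)"
    using conn aG x unfolding connected_iff_rtrancl by auto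
  then obtain xs where xs: "list_path xs" "xs \<noteq> []" "hd xs = a" "last xs = x"
    using reach_in_path[OF _ aG] by blast
  have "\<exists>t\<in>set xs. t \<in> pverts T" using xs(2,3) a by (auto intro!: bexI[of _ a])
  then obtain ys t q where q: "xs = ys @ t # q" "t \<in> pverts T" "\<forall>z\<in>set q. z \<notin> pverts T"
    using split_list_last_prop[of xs "\<lambda>t. t \<in> pverts T"] by blast
  then have "q \<noteq> []" using xs(4) x by auto
  moreover have "list_path (t # q)"
    using xs(1) unfolding q(1) list_path_def by (auto simp: successively_append_iff)
  ultimately show thesis using that q xs(4) by auto
qed

lemma subtree_absorb_path:
  assumes T: "subtree T" "t \<in> pverts T" "list_path (t # q)" "set q \<inter> pverts T = {}"
  obtains T' where "subtree T'" "pverts T' = pverts T \<union> set q"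
    "card (branch_vertices T') \<le> card (branch_vertices T) + 1"
proof -
  obtain T' where T': "subtree T'" "pverts T' = pverts T \<union> set q"
    and deg: "\<And>v. in_degree (with_proj T') v \<le>
       (if v \<in> set q then 2 else in_degree (with_proj T) v + (if v = t then 1 else 0))"
    using subtree_add_path[OF T] by blast
  have "branch_vertices T' \<subseteq> insert t (branch_vertices T)"
  proof
    fix v assume "v \<in> branch_vertices T'"
    then have "v \<in> pverts T'" "3 \<le> in_degree (with_proj T') v"
      unfolding branch_vertices_def by auto
    then show "v \<in> insert t (branch_vertices T)"
      using deg[of v] T'(2) unfolding branch_vertices_def by (auto split: if_splits)
  qed
  moreover have "finite (branch_vertices T)"
    using subtree_finite[OF T(1)] unfolding branch_vertices_def by simp
  ultimately have "card (branch_vertices T') \<le> card (insert t (branch_vertices T))"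
    by (intro card_mono) auto
  also have "\<dots> \<le> card (branch_vertices T) + 1" by (simp add: card_insert_le_m1 card_insert_if \<open>finite (branch_vertices T)\<close>)
  finally show thesis using that T' by blast
qed

lemma subtree_of_path:
  assumes "list_path P" "P \<noteq> []"
  obtains T where "subtree T" "pverts T = set P" "branch_vertices T = {}"
proof -
  obtain a q where P: "P = a # q" using assms(2) by (cases P) auto
  let ?A = "\<lparr>pverts = {a}, parcs = {}\<rparr>"
  have "a \<in> pverts G" "a \<notin> set q" using assms(1) unfolding P list_path_def by auto
  then obtain T where T: "subtree T" "pverts T = set P"
    and deg: "\<And>v. in_degree (with_proj T) v \<le>
       (if v \<in> set q then 2 else in_degree (with_proj ?A) v + (if v = a then 1 else 0))"
    using subtree_add_path[OF subtree_singleton, of a a q] assms(1) unfolding P by auto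
  have "in_degree (with_proj ?A) v = 0" for v by (simp add: in_degree_def in_arcs_def)
  then have "in_degree (with_proj T) v < 3" for v using deg[of v] by (auto split: if_splits)
  then have "branch_vertices T = {}" unfolding branch_vertices_def by (simp add: not_le)
  then show thesis using that T by blast
qed

text \<open>
  Every attached path costs at most one branch vertex and pays for it: its end is a vertex of \<open>R\<close>
  that could be added to any independent set in what remains of \<open>R\<close>, for otherwise the path could be
  prolonged to collect one more vertex of \<open>R\<close>.
\<close>
lemma subtree_covering:
  assumes conn: "Digraph_Component.connected (with_proj G)" and R: "R \<subseteq> pverts G"
    and "subtree T"
  shows "\<exists>T'. subtree T' \<and> pverts T \<union> R \<subseteq> pverts T' \<and>
    card (branch_vertices T') \<le> card (branch_vertices T) + alpha (R - pverts T)"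
  using assms(3)
proof (induction "alpha (R - pverts T)" arbitrary: T rule: less_induct)
  case less
  show ?case
  proof (cases "R \<subseteq> pverts T")
    case True
    then show ?thesis using less.prems by (intro exI[of _ T]) auto
  next
    case False
    let ?ok = "\<lambda>(t, q). t \<in> pverts T \<and> list_path (t # q) \<and> q \<noteq> [] \<and> last q \<in> R \<and> set q \<inter> pverts T = {}"
    let ?gain = "\<lambda>(t, q). card (R \<inter> set q)"
    have "finite R" using R pair_finite_verts finite_subset by blast
    from False obtain x where x: "x \<in> R" "x \<in> pverts G - pverts T" using R by auto
    obtain t0 q0 where "t0 \<in> pverts T" "list_path (t0 # q0)" "q0 \<noteq> []" "last q0 = x"
      "set q0 \<inter> pverts T = {}"
      by (rule path_out_of_subtree[OF conn less.prems x(2)])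
    with x(1) have "?ok (t0, q0)" by simp
    moreover have "\<forall>z. ?ok z \<longrightarrow> ?gain z < card R + 1"
      using \<open>finite R\<close> by (auto simp: less_Suc_eq_le intro!: card_mono)
    ultimately have "\<exists>z. ?ok z \<and> (\<forall>z'. ?ok z' \<longrightarrow> ?gain z' \<le> ?gain z)"
      by (rule ex_has_greatest_nat)
    then obtain z where z: "?ok z" and max: "\<forall>z'. ?ok z' \<longrightarrow> ?gain z' \<le> ?gain z"
      by (elim exE conjE) (rule that)
    obtain t q where tq: "z = (t, q)" by (cases z)
    have t: "t \<in> pverts T" "list_path (t # q)" "q \<noteq> []" "last q \<in> R" "set q \<inter> pverts T = {}"
      using z unfolding tq by auto
    let ?v = "last q"
    obtain T' where T': "subtree T'" "pverts T' = pverts T \<union> set q"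
      "card (branch_vertices T') \<le> card (branch_vertices T) + 1"
      using subtree_absorb_path[OF less.prems t(1,2,5)] by blast
    have nonadj: "(?v, w) \<notin> parcs G" if w: "w \<in> R - pverts T'" for w
    proof
      assume e: "(?v, w) \<in> parcs G"
      have "w \<notin> set q" "w \<notin> pverts T" using w T'(2) by auto
      have "list_path (t # q @ [w])"
        using t(1,2,3) e w R \<open>w \<notin> set q\<close> \<open>w \<notin> pverts T\<close>
        by (auto simp: list_path_def successively_append_iff simp flip: append_Cons)
      then have "?ok (t, q @ [w])" using t w \<open>w \<notin> pverts T\<close> by auto
      then have "card (R \<inter> set (q @ [w])) \<le> card (R \<inter> set q)" using max[rule_format, of "(t, q @ [w])"] tq by simp
      moreover have "R \<inter> set (q @ [w]) = insert w (R \<inter> set q)" using w by auto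
      ultimately show False using \<open>w \<notin> set q\<close> by simp
    qed
    have v: "?v \<in> set q" using t(3) by simp
    have "1 + alpha (R - pverts T') \<le> alpha {?v} + alpha (R - pverts T')"
      using alpha_pos[of ?v "{?v}"] t(4) R by auto
    also have "\<dots> = alpha ({?v} \<union> (R - pverts T'))"
      using nonadj v T'(2) by (intro alpha_Un_disjoint[symmetric]) auto
    also have "\<dots> \<le> alpha (R - pverts T)"
      using v t(4,5) T'(2) by (intro alpha_mono) auto
    finally have drop: "1 + alpha (R - pverts T') \<le> alpha (R - pverts T)" .
    then obtain T'' where "subtree T''" "pverts T' \<union> R \<subseteq> pverts T''"
      "card (branch_vertices T'') \<le> card (branch_vertices T') + alpha (R - pverts T')"
      using less.hyps[of T'] T'(1) by auto
    then show ?thesis using T' drop by (intro exI[of _ T'']) auto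
  qed
qed

end

theorem corollary1p6:
  fixes G :: "'a pair_pre_digraph" and S :: "'a set" and k :: nat
  assumes "pair_graph G"
    and "Digraph_Component.connected (with_proj G)"
    and "2 \<le> k"
    and "S \<subseteq> pverts G"
    and "enat (independence_number_on G S) \<le> enat k + connectivity_on G S - 1"
  shows "\<exists>T :: 'a pair_pre_digraph.
    subgraph (with_proj T) (with_proj G) \<and> undirected_tree T \<and> S \<subseteq> pverts T \<and>
    card (branch_vertices T) \<le> k - 2"
proof -
  interpret pair_graph G by fact
  obtain P where P: "list_path P"
    "S \<subseteq> set P \<or> enat (alpha (S - set P)) + connectivity_on G S + 1 \<le> enat (alpha S)"
    using path_dropping_alpha[OF assms(4)] by blast
  have few: "alpha (S - set P) \<le> k - 2"
    using P(2)
  proof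
    assume "S \<subseteq> set P"
    then have "S - set P = {}" by auto
    then show ?thesis by (metis alpha_attained card.empty subset_empty le0)
  next
    assume le: "enat (alpha (S - set P)) + connectivity_on G S + 1 \<le> enat (alpha S)"
    then obtain c where c: "connectivity_on G S = enat c"
      by (cases "connectivity_on G S") auto
    show ?thesis using le assms(3,5) unfolding c by (simp add: one_enat_def)
  qed
  obtain v where v: "v \<in> pverts G"
    using assms(2) unfolding connected_iff_rtrancl by auto
  \<comment> \<open>\<open>P\<close> may be empty, but the tree needs a vertex to start from.\<close>
  obtain P' where P': "list_path P'" "P' \<noteq> []" "set P \<subseteq> set P'"
  proof (cases P)
    case Nil
    then show thesis using that[of "[v]"] v by (simp add: list_path_def)
  next
    case (Cons a xs)
    then show thesis using that[of P] P(1) by simp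
  qed
  obtain T where T: "subtree T" "pverts T = set P'" "branch_vertices T = {}"
    using subtree_of_path[OF P'(1,2)] by blast
  obtain T' where T': "subtree T'" "pverts T \<union> S \<subseteq> pverts T'"
    "card (branch_vertices T') \<le> card (branch_vertices T) + alpha (S - pverts T)"
    using subtree_covering[OF assms(2,4) T(1)] by blast
  have "alpha (S - pverts T) \<le> alpha (S - set P)"
    using P'(3) T(2) by (intro alpha_mono) auto
  then have "card (branch_vertices T') \<le> k - 2" using T'(3) T(3) few by simp
  then show ?thesis using T' unfolding subtree_def by blast
qed

end
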